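(* For each integer $n\ge 3$ let $B_n=\{1,5,25,26\}\cup\{3,3^2,3^3,\dots,3^n\}$, and let $B=\bigcup_{n=3}^{\infty}B_n$. Then there is an arithmetic map $\phi:B\to\mathbb{Q}$ which moves all $r\in B\setminus\{1\}$, i.e. $\phi(r)\ne r$ for every $r\in B\setminus\{1\}$. Moreover, for each integer $n\ge 3$ and each $r\in B_n\setminus\{1,5\}$: (i) $B_n$ is an arithmetic neighbourhood of $r$ inside $\mathbb{Z}$; (ii) $B_n$ is not an arithmetic neighbourhood of $r$ inside $\mathbb{Q}$.
   Context: Let $K$ be a ring (with $1$) and $A\subseteq K$. A map $f:A\to K$ is called arithmetic if: (1) if $1\in A$ then $f(1)=1$; (2) if $a,b\in A$ and $a+b\in A$ then $f(a+b)=f(a)+f(b)$; (3) if $a,b\in A$ and $a\cdot b\in A$ then $f(a\cdot b)=f(a)\cdot f(b)$. (In (2) and (3), $a=b$ is allowed.) A finite set $A\subseteq K$ with $r\in A$ is an arithmetic neighbourhood of $r$ inside $K$ if every arithmetic map $f:A\to K$ satisfies $f(r)=r$. *)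

theory Defs
  imports Complex_Main
begin

text \<open>The ring \<open>K\<close> is the whole type. Maps \<open>A \<rightarrow> K\<close> are total functions on that type; only
  their values on \<open>A\<close> are constrained or inspected.\<close>

definition arithmetic_map :: "'a::ring_1 set \<Rightarrow> ('a \<Rightarrow> 'a) \<Rightarrow> bool" where
  "arithmetic_map A f \<longleftrightarrow>
     (1 \<in> A \<longrightarrow> f 1 = 1) \<and>
     (\<forall>a\<in>A. \<forall>b\<in>A. a + b \<in> A \<longrightarrow> f (a + b) = f a + f b) \<and>
     (\<forall>a\<in>A. \<forall>b\<in>A. a * b \<in> A \<longrightarrow> f (a * b) = f a * f b)"

definition arithmetic_neighbourhood :: "'a::ring_1 set \<Rightarrow> 'a \<Rightarrow> bool" where
  "arithmetic_neighbourhood A r \<longleftrightarrow>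
     finite A \<and> r \<in> A \<and> (\<forall>f. arithmetic_map A f \<longrightarrow> f r = r)"

definition B_fin :: "nat \<Rightarrow> int set" where
  "B_fin n = {1, 5, 25, 26} \<union> (\<lambda>k. 3 ^ k) ` {1..n}"

definition B_all :: "int set" where
  "B_all = (\<Union>n\<in>{3..}. B_fin n)"

end

theory Submission
  imports Defs
begin

text \<open>
  Inside \<open>B\<close> the only sums are \<open>1 + 25 = 26\<close> and \<open>1 + 26 = 27\<close>, and the only products
  not involving \<open>1\<close> are \<open>5 \<cdot> 5 = 25\<close> and the products of powers of \<open>3\<close>. An arithmetic map
  is therefore the same thing as a choice of images \<open>x\<close> of \<open>3\<close> and \<open>y\<close> of \<open>5\<close> on the
  elliptic curve \<open>y\<^sup>2 + 2 = x\<^sup>3\<close>; the other values are forced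
  to be \<open>x\<^sup>k\<close>, \<open>y\<^sup>2\<close> and \<open>y\<^sup>2 + 1\<close>.

  Over the rationals, doubling the point \<open>(3, 5)\<close> on the curve gives
  \<open>(129/100, 383/1000)\<close>, and the corresponding map moves everything except \<open>1\<close>
  (\<open>curve_point_map_arithmetic\<close>, \<open>curve_point_map_moves\<close>).

  Over the integers, Fermat showed that \<open>(3, \<plusminus>5)\<close> are the only points
  (\<open>fermat_square_plus_two_eq_cube\<close>), which fixes every element except possibly \<open>5\<close>. A solution
  yields the binary quadratic form \<open>x X\<^sup>2 + 2 y X Y + x\<^sup>2 Y\<^sup>2\<close> of discriminant \<open>-8\<close>. All
  positive forms of this discriminant are equivalent to \<open>X\<^sup>2 + 2 Y\<^sup>2\<close>
  (\<open>form_of_determinant_two_reduces\<close>), so \<open>x = a\<^sup>2 + 2 c\<^sup>2\<close> and \<open>x\<^sup>2 = b\<^sup>2 + 2 d\<^sup>2\<close>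
  with \<open>a d - b c = 1\<close>. Squaring \<open>a + c \<surd>-2\<close> gives a second representation of \<open>x\<^sup>2\<close>. The two
  coincide up to signs, by a divisibility argument
  (\<open>unimodular_square_representation\<close>), and then the determinant condition becomes
  \<open>c (3 a\<^sup>2 - 2 c\<^sup>2) = \<plusminus>1\<close>, whence \<open>x = 3\<close>.
\<close>

section \<open>Binary quadratic forms of determinant two\<close>

text \<open>
  Gauss reduction: while \<open>2 \<bar>q\<bar>\<close> exceeds one of the outer coefficients, a shear makes \<open>p + r\<close>
  smaller. Once it exceeds neither, \<open>4 q\<^sup>2 \<le> p r = q\<^sup>2 + 2\<close> leaves only \<open>q = 0\<close> and
  \<open>p r = 2\<close>.
\<close>

lemma form_of_determinant_two_reduces:
  fixes p q r :: int
  assumes "p > 0" "p * r - q\<^sup>2 = 2"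
  shows "\<exists>a b c d. a * d - b * c = 1 \<and> p = a\<^sup>2 + 2 * c\<^sup>2 \<and>
           q = a * b + 2 * c * d \<and> r = b\<^sup>2 + 2 * d\<^sup>2"
  using assms
proof (induction "nat (p + r)" arbitrary: p q r rule: less_induct)
  case less
  have "p * r > 0"
    using less.prems(2) zero_le_power2[of q] by linarith
  then have r: "r > 0"
    using less.prems(1) by (simp add: zero_less_mult_iff)
  consider (right) s where "s = 1 \<or> s = -1" "p < 2 * (s * q)"
    | (left) s where "s = 1 \<or> s = -1" "r < 2 * (s * q)"
    | (reduced) "2 * \<bar>q\<bar> \<le> p" "2 * \<bar>q\<bar> \<le> r"
    by (metis abs_if minus_mult_left mult_1 not_le)
  then show ?case
  proof cases
    case right
    have s2: "s * s = 1"
      using right(1) by auto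
    have det: "p * (r - 2 * (s * q) + p) - (q - s * p)\<^sup>2 = 2"
      using less.prems(2) s2 by (simp add: algebra_simps power2_eq_square)
    then have "p * (r - 2 * (s * q) + p) > 0"
      using zero_le_power2[of "q - s * p"] by linarith
    then have "nat (p + (r - 2 * (s * q) + p)) < nat (p + r)"
      using right(2) less.prems(1) by (simp add: zero_less_mult_iff)
    from less.hyps[OF this less.prems(1) det] obtain a b c d where
      *: "a * d - b * c = 1" "p = a\<^sup>2 + 2 * c\<^sup>2" "q - s * p = a * b + 2 * c * d"
         "r - 2 * (s * q) + p = b\<^sup>2 + 2 * d\<^sup>2"
      by blast
    have "a * (d + s * c) - (b + s * a) * c = 1"
      using *(1) by (simp add: algebra_simps)
    moreover have "q = a * (b + s * a) + 2 * c * (d + s * c)"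
      using *(2,3) by algebra
    moreover have "r = (b + s * a)\<^sup>2 + 2 * (d + s * c)\<^sup>2"
      using *(2,3,4) s2 by algebra
    ultimately show ?thesis
      using *(2) by blast
  next
    case left
    have s2: "s * s = 1"
      using left(1) by auto
    have det: "(p - 2 * (s * q) + r) * r - (q - s * r)\<^sup>2 = 2"
      using less.prems(2) s2 by (simp add: algebra_simps power2_eq_square)
    then have "(p - 2 * (s * q) + r) * r > 0"
      using zero_le_power2[of "q - s * r"] by linarith
    then have pos: "p - 2 * (s * q) + r > 0"
      using r by (simp add: zero_less_mult_iff)
    then have "nat ((p - 2 * (s * q) + r) + r) < nat (p + r)"
      using left(2) r by simp
    from less.hyps[OF this pos det] obtain a b c d where
      *: "a * d - b * c = 1" "p - 2 * (s * q) + r = a\<^sup>2 + 2 * c\<^sup>2"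
         "q - s * r = a * b + 2 * c * d" "r = b\<^sup>2 + 2 * d\<^sup>2"
      by blast
    have "(a + s * b) * d - b * (c + s * d) = 1"
      using *(1) by (simp add: algebra_simps)
    moreover have "q = (a + s * b) * b + 2 * (c + s * d) * d"
      using *(3,4) by algebra
    moreover have "p = (a + s * b)\<^sup>2 + 2 * (c + s * d)\<^sup>2"
      using *(2,3,4) s2 by algebra
    ultimately show ?thesis
      using *(4) by blast
  next
    case reduced
    have "(2 * \<bar>q\<bar>) * (2 * \<bar>q\<bar>) \<le> p * r"
      using reduced less.prems(1) by (intro mult_mono) auto
    then have "4 * q\<^sup>2 \<le> q\<^sup>2 + 2"
      using less.prems(2) by (simp add: power2_eq_square)
    then have "q\<^sup>2 < 1"
      by linarith
    then have "\<bar>q\<bar> < 1"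
      by (simp only: abs_square_less_1)
    then have q: "q = 0"
      by linarith
    then have pr: "p * r = 2"
      using less.prems(2) by simp
    then have "p \<le> 2"
      using less.prems(1) r by (metis dvd_triv_left zdvd_imp_le zero_less_numeral)
    then have "p = 1 \<or> p = 2"
      using less.prems(1) by linarith
    then consider "p = 1" "r = 2" | "p = 2" "r = 1"
      using pr by auto
    then show ?thesis
    proof cases
      case 1
      then show ?thesis
        using q by (intro exI[of _ 1] exI[of _ 0]) simp
    next
      case 2
      then show ?thesis
        using q by (intro exI[of _ 0] exI[of _ "-1"] exI[of _ 1]) simp
    qed
  qed
qed

section \<open>The equation \<open>y\<^sup>2 + 2 = x\<^sup>3\<close> over the integers\<close>

text \<open>
  Put \<open>e = a\<^sup>2 - 2 c\<^sup>2\<close> and \<open>f = 2 a c\<close>, so that \<open>(a + c \<surd>-2)\<^sup>2 = e + f \<surd>-2\<close> has the same norm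
  \<open>x\<^sup>2\<close> as \<open>b + d \<surd>-2\<close>. Comparing norms, \<open>x\<^sup>2\<close> divides \<open>(d e - b f) (d e + b f)\<close>.
  Its first factor is \<open>2 a - d x\<close>, which is coprime to \<open>x\<close>, so \<open>x\<^sup>2\<close> divides \<open>d e + b f\<close>. The
  product of \<open>b + d \<surd>-2\<close> and \<open>e + f \<surd>-2\<close> has norm \<open>x\<^sup>4\<close> and \<open>\<surd>-2\<close>-part \<open>d e + b f\<close>, which is
  thus too small to be a nonzero multiple of \<open>x\<^sup>2\<close>.
\<close>

lemma unimodular_square_representation:
  fixes a b c d x :: int
  assumes det: "a * d - b * c = 1"
    and x: "x = a\<^sup>2 + 2 * c\<^sup>2" "odd x"
    and xx: "x\<^sup>2 = b\<^sup>2 + 2 * d\<^sup>2"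
  shows "d * (a\<^sup>2 - 2 * c\<^sup>2) + b * (2 * a * c) = 0"
proof -
  define e f where "e = a\<^sup>2 - 2 * c\<^sup>2" and "f = 2 * a * c"
  define S T where "S = b * e - 2 * (d * f)" and "T = d * e + b * f"
  have ef: "x\<^sup>2 = e\<^sup>2 + 2 * f\<^sup>2"
    unfolding e_def f_def x(1) by algebra
  have cop: "coprime (2 * a - d * x) x"
  proof -
    have "coprime a c"
    proof (rule coprimeI)
      fix g assume "g dvd a" "g dvd c"
      then have "g dvd a * d - b * c"
        by simp
      then show "is_unit g"
        using det by simp
    qed
    moreover have "odd a"
      using x by auto
    ultimately have "coprime a (2 * c\<^sup>2)"
      by simp
    then have "coprime a x"
      unfolding x(1) by (simp add: coprime_iff_gcd_eq_1 power2_eq_square gcd_add_mult)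
    then have "coprime (2 * a) x"
      using x(2) by simp
    then show ?thesis
      by (metis coprime_iff_gcd_eq_1 diff_conv_add_uminus gcd.commute gcd_add_mult
          add.commute minus_mult_left)
  qed
  have "T * (2 * a - d * x) = x\<^sup>2 * (d\<^sup>2 - f\<^sup>2)"
  proof -
    have "2 * a - d * x = d * e - b * f"
      unfolding e_def f_def x(1) using det by algebra
    then show ?thesis
      unfolding T_def using ef xx by algebra
  qed
  then have "x\<^sup>2 dvd T * (2 * a - d * x)"
    by simp
  then have "x\<^sup>2 dvd T"
    using cop by (simp add: coprime_dvd_mult_left_iff coprime_commute)
  then obtain t where t: "T = x\<^sup>2 * t"
    by (elim dvdE)
  have "S\<^sup>2 + 2 * T\<^sup>2 = (x\<^sup>2)\<^sup>2"
    unfolding S_def T_def using ef xx by algebra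
  then have "S\<^sup>2 + (x\<^sup>2)\<^sup>2 * (2 * t\<^sup>2) = (x\<^sup>2)\<^sup>2 * 1"
    unfolding t by (simp add: power_mult_distrib)
  then have "(x\<^sup>2)\<^sup>2 * (2 * t\<^sup>2) \<le> (x\<^sup>2)\<^sup>2 * 1"
    using zero_le_power2[of S] by linarith
  moreover have "(x\<^sup>2)\<^sup>2 > 0"
    using x(2) by auto
  ultimately have "2 * t\<^sup>2 \<le> 1"
    by (metis mult_le_cancel_left_pos)
  then have "t\<^sup>2 < 1"
    by linarith
  then have "\<bar>t\<bar> < 1"
    by (simp only: abs_square_less_1)
  then have "t = 0"
    by linarith
  then show ?thesis
    using t unfolding T_def e_def f_def by simp
qed

text \<open>
  The form with coefficients \<open>x\<close>, \<open>y\<close>, \<open>x\<^sup>2\<close> has determinant two precisely because of the equation.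
  Its reduction and the previous lemma replace the use of unique factorization in
  \<open>\<int>[\<surd>-2]\<close>.
\<close>

lemma fermat_square_plus_two_eq_cube:
  fixes x y :: int
  assumes eq: "y\<^sup>2 + 2 = x ^ 3"
  shows "x = 3"
proof -
  have pos: "x > 0"
  proof (rule ccontr)
    assume "\<not> x > 0"
    then have "x ^ 3 \<le> 0"
      by (simp add: power_le_zero_eq)
    then show False
      using eq zero_le_power2[of y] by linarith
  qed
  have odd: "odd x"
  proof
    \<comment> \<open>Modulo \<open>4\<close>, the left hand side would be \<open>2\<close> and the right hand side \<open>0\<close>.\<close>
    assume "even x"
    moreover from this have "even (y\<^sup>2 + 2)"
      using eq by simp
    then have "even y"
      by simp
    ultimately obtain u v where "x = 2 * u" "y = 2 * v"
      by (elim evenE)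
    then have "2 * (2 * u ^ 3 - v\<^sup>2) = 1"
      using eq by (simp add: power_mult_distrib)
    then show False
      by presburger
  qed
  have "x * x\<^sup>2 - y\<^sup>2 = 2"
    using eq by (simp add: power3_eq_cube power2_eq_square)
  from form_of_determinant_two_reduces[OF pos this] obtain a b c d where
    *: "a * d - b * c = 1" "x = a\<^sup>2 + 2 * c\<^sup>2" "x\<^sup>2 = b\<^sup>2 + 2 * d\<^sup>2"
    by blast
  have T: "d * (a\<^sup>2 - 2 * c\<^sup>2) + b * (2 * a * c) = 0"
    by (rule unimodular_square_representation) (use * odd in auto)
  have "a \<noteq> 0"
    using odd *(2) by auto
  have "x\<^sup>2 * (d\<^sup>2 - (2 * a * c)\<^sup>2) = 0"
  proof -
    have "x\<^sup>2 = (a\<^sup>2 - 2 * c\<^sup>2)\<^sup>2 + 2 * (2 * a * c)\<^sup>2"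
      unfolding *(2) by algebra
    then show ?thesis
      using *(3) T by algebra
  qed
  then have "d\<^sup>2 = (2 * a * c)\<^sup>2"
    using pos by simp
  then have d: "d = 2 * a * c \<or> d = - (2 * a * c)"
    by (simp add: power2_eq_iff)
  \<comment> \<open>Eliminating \<open>b\<close> between \<open>T\<close> and the determinant condition.\<close>
  have "d * (3 * a\<^sup>2 - 2 * c\<^sup>2) = 2 * a"
    using T *(1) by algebra
  then have "(2 * a) * (c * (3 * a\<^sup>2 - 2 * c\<^sup>2)) = (2 * a) * 1 \<or>
      (2 * a) * (c * (3 * a\<^sup>2 - 2 * c\<^sup>2)) = (2 * a) * (-1)"
    using d by (auto simp: algebra_simps)
  then have unit: "c * (3 * a\<^sup>2 - 2 * c\<^sup>2) = 1 \<or> c * (3 * a\<^sup>2 - 2 * c\<^sup>2) = -1"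
    using \<open>a \<noteq> 0\<close> by (metis mult_cancel_left mult_eq_0_iff zero_neq_numeral)
  then have "c dvd 1"
    by (metis dvd_minus_iff dvd_triv_left)
  then have c: "c\<^sup>2 = 1"
    by (simp add: power2_eq_1_iff zdvd1_eq abs_if split: if_splits)
  then have "c = 1 \<or> c = -1"
    by (simp add: power2_eq_1_iff)
  then have "3 * a\<^sup>2 = 3 \<or> 3 * a\<^sup>2 = 1"
    using unit c by auto
  then have "a\<^sup>2 = 1"
    by presburger
  then show ?thesis
    using *(2) c by simp
qed

section \<open>Sums and products inside \<open>B\<close>\<close>

lemma B_all_eq: "B_all = {5, 25, 26} \<union> range (\<lambda>k. 3 ^ k)"
proof
  show "B_all \<subseteq> {5, 25, 26} \<union> range (\<lambda>k. 3 ^ k)"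
    unfolding B_all_def B_fin_def by (auto intro: range_eqI[of _ _ 0])
  have "(3::int) ^ k \<in> B_fin (max 3 k)" for k
    unfolding B_fin_def by (cases "k = 0") auto
  moreover have "{5, 25, 26} \<subseteq> B_fin 3"
    unfolding B_fin_def by auto
  ultimately show "{5, 25, 26} \<union> range (\<lambda>k. 3 ^ k) \<subseteq> B_all"
    unfolding B_all_def by fastforce
qed

lemma B_all_cases:
  assumes "a \<in> B_all"
  obtains "a = 1" | "a = 5" | "a = 25" | "a = 26" | k where "a = 3 * 3 ^ k"
  using assms unfolding B_all_eq
  by (auto) (metis not0_implies_Suc power_0 power_Suc)

lemma B_all_pos: "a \<in> B_all \<Longrightarrow> a > 0"
  by (auto simp: B_all_eq)

lemma B_all_even: "a \<in> B_all \<Longrightarrow> even a \<Longrightarrow> a = 26"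
  by (auto simp: B_all_eq)

lemma B_all_multiple_of_five:
  assumes "a \<in> B_all" "5 dvd a"
  shows "a \<in> {5, 25}"
proof -
  have "\<not> 5 dvd (3::int) ^ k" for k
  proof (induction k)
    case (Suc k)
    then show ?case
      unfolding power_Suc by presburger
  qed simp
  then show ?thesis
    using assms by (auto simp: B_all_eq)
qed

text \<open>
  The number \<open>26\<close> is the only even element, so a sum either equals \<open>26\<close>, which bounds the
  summands, or has \<open>26\<close> as a summand. In the second case the sum is a power of \<open>3\<close>, which
  excludes every other summand except \<open>1\<close>.
\<close>

lemma B_all_sums:
  assumes "a \<in> B_all" "b \<in> B_all" "a + b \<in> B_all"
  shows "{a, b} = {1, 25} \<or> {a, b} = {1, 26}"
proof -
  have add26: "c = 1" if "c \<in> B_all" "26 + c \<in> B_all" for c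
    using that(2)
  proof (cases rule: B_all_cases)
    case (5 m)
    show ?thesis
      using that(1)
    proof (cases rule: B_all_cases)
      case 3
      \<comment> \<open>Here \<open>51 = 3 \<cdot> 17\<close> would have to be a power of \<open>3\<close>.\<close>
      then have "(3::int) ^ m = 17"
        using 5 by simp
      moreover have "(3::int) ^ m = 1 \<or> 3 dvd (3::int) ^ m"
        by (cases m) auto
      ultimately show ?thesis
        by presburger
    qed (use 5 in presburger)+
  qed (use B_all_pos[OF that(1)] in auto)
  show ?thesis
  proof (cases "a = 26 \<or> b = 26")
    case True
    then show ?thesis
      using add26[of a] add26[of b] assms by (auto simp: add.commute)
  next
    case False
    then have "even (a + b)"
      using B_all_even assms by auto
    then have sum: "a + b = 26"
      using B_all_even assms(3) by blast
    have small: "c \<in> {1, 3, 5, 9, 25}" if "c \<in> B_all" "c < 26" for c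
      using that(1)
    proof (cases rule: B_all_cases)
      case (5 k)
      have "k < 2"
      proof (rule ccontr)
        assume "\<not> k < 2"
        then have "(3::int) ^ 2 \<le> 3 ^ k"
          by (intro power_increasing) auto
        then show False
          using 5 that(2) by simp
      qed
      then have "k = 0 \<or> k = 1"
        by linarith
      then show ?thesis
        using 5 by auto
    qed (use that(2) in auto)
    have "a \<in> {1, 3, 5, 9, 25}" "b \<in> {1, 3, 5, 9, 25}"
      using small B_all_pos[OF assms(1)] B_all_pos[OF assms(2)] assms(1,2) sum by auto
    then show ?thesis
      using sum by auto
  qed
qed

text \<open>
  A product with \<open>26\<close> is even, and a product with \<open>5\<close> or \<open>25\<close> is a multiple of \<open>5\<close>. Such
  elements of \<open>B\<close> are too few to allow anything but \<open>5 \<cdot> 5\<close> and multiplication by \<open>1\<close>.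
\<close>

lemma B_all_products:
  assumes "a \<in> B_all" "b \<in> B_all" "a * b \<in> B_all"
  obtains "a = 1" | "b = 1" | "a = 5" "b = 5" | j k where "a = 3 ^ j" "b = 3 ^ k"
proof -
  have mult26: "c = 1" if "c \<in> B_all" "26 * c \<in> B_all" for c
    using B_all_even[OF that(2)] by simp
  have mult25: "c = 1" if "c \<in> B_all" "25 * c \<in> B_all" for c
  proof -
    have "25 * c = 5 \<or> 25 * c = 25"
      using B_all_multiple_of_five[OF that(2)] by simp
    then show ?thesis
      by presburger
  qed
  have mult5: "c = 1 \<or> c = 5" if "c \<in> B_all" "5 * c \<in> B_all" for c
    using B_all_multiple_of_five[OF that(2)] by auto
  have special: "c = 1 \<or> c = 5 \<and> d = 5"
    if "d \<in> {5, 25, 26}" "c \<in> B_all" "d * c \<in> B_all" for c d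
    using that mult26[of c] mult25[of c] mult5[of c] by auto
  consider "a \<in> {5, 25, 26}" | "b \<in> {5, 25, 26}" | j k where "a = 3 ^ j" "b = 3 ^ k"
    using assms(1,2) unfolding B_all_eq by blast
  then show ?thesis
  proof cases
    case 1
    then show ?thesis
      using special[of a b] assms that(2,3) by blast
  next
    case 2
    then show ?thesis
      using special[of b a] assms that(1,3) by (metis mult.commute)
  qed (use that(4) in blast)
qed

section \<open>The rational map\<close>

text \<open>The point is the double of \<open>(3, 5)\<close>: the tangent there has slope \<open>27/10\<close>.\<close>

definition curve_point_map :: "rat \<Rightarrow> rat" where
  "curve_point_map r =
     (if r = 5 then 383 / 1000
      else if r = 25 then (383 / 1000)\<^sup>2
      else if r = 26 then (383 / 1000)\<^sup>2 + 1
      else (129 / 100) ^ inv (\<lambda>k. 3 ^ k :: rat) r)"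

lemma curve_point_map_simps [simp]:
  "curve_point_map 5 = 383 / 1000"
  "curve_point_map 25 = (383 / 1000)\<^sup>2"
  "curve_point_map 26 = (383 / 1000)\<^sup>2 + 1"
  by (simp_all add: curve_point_map_def)

lemma curve_point_map_power: "curve_point_map (3 ^ k) = (129 / 100) ^ k"
proof -
  have inj: "inj (\<lambda>k. 3 ^ k :: rat)"
    by (rule injI) simp
  have "(3::int) ^ k \<notin> {5, 25, 26}"
  proof -
    have "(3::int) ^ k = 1 \<or> 3 dvd (3::int) ^ k"
      by (cases k) auto
    then show ?thesis
      by auto
  qed
  then have "rat_of_int (3 ^ k) \<notin> rat_of_int ` {5, 25, 26}"
    by (metis (no_types, lifting) image_iff of_int_eq_iff)
  then show ?thesis
    by (simp add: curve_point_map_def inv_f_f[OF inj])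
qed

lemma curve_point_map_one [simp]: "curve_point_map 1 = 1"
  using curve_point_map_power[of 0] by simp

lemma curve_point_map_arithmetic: "arithmetic_map (rat_of_int ` B_all) curve_point_map"
proof -
  have 27: "curve_point_map 27 = (129 / 100) ^ 3"
    using curve_point_map_power[of 3] by simp
  have add: "curve_point_map (of_int (a + b)) =
      curve_point_map (of_int a) + curve_point_map (of_int b)"
    if "a \<in> B_all" "b \<in> B_all" "a + b \<in> B_all" for a b
    using B_all_sums[OF that] 27
    by (auto simp: doubleton_eq_iff power2_eq_square power3_eq_cube)
  have mult: "curve_point_map (of_int (a * b)) =
      curve_point_map (of_int a) * curve_point_map (of_int b)"
    if "a \<in> B_all" "b \<in> B_all" "a * b \<in> B_all" for a b
    using that
  proof (cases rule: B_all_products)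
    case (4 j k)
    then have "rat_of_int (a * b) = 3 ^ (j + k)" "rat_of_int a = 3 ^ j" "rat_of_int b = 3 ^ k"
      by (simp_all add: power_add)
    then show ?thesis
      by (simp only: curve_point_map_power) (rule power_add)
  qed (auto simp: power2_eq_square)
  show ?thesis
    unfolding arithmetic_map_def
  proof (intro conjI impI ballI)
    fix u v assume "u \<in> rat_of_int ` B_all" "v \<in> rat_of_int ` B_all"
    then obtain a b where ab: "u = of_int a" "v = of_int b" "a \<in> B_all" "b \<in> B_all"
      by blast
    show "curve_point_map (u + v) = curve_point_map u + curve_point_map v"
      if "u + v \<in> rat_of_int ` B_all"
    proof -
      have "a + b \<in> B_all"
        using that ab by (metis image_iff of_int_add of_int_eq_iff)
      then show ?thesis
        using add[of a b] ab by simp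
    qed
    show "curve_point_map (u * v) = curve_point_map u * curve_point_map v"
      if "u * v \<in> rat_of_int ` B_all"
    proof -
      have "a * b \<in> B_all"
        using that ab by (metis image_iff of_int_mult of_int_eq_iff)
      then show ?thesis
        using mult[of a b] ab by simp
    qed
  qed simp
qed

lemma curve_point_map_moves:
  assumes "r \<in> B_all" "r \<noteq> 1"
  shows "curve_point_map (of_int r) \<noteq> of_int r"
  using assms(1)
proof (cases rule: B_all_cases)
  case (5 k)
  then have r: "rat_of_int r = 3 ^ Suc k"
    by simp
  have "(129 / 100 :: rat) ^ Suc k < 3 ^ Suc k"
    by (intro power_strict_mono) auto
  then show ?thesis
    unfolding r curve_point_map_power by simp
qed (use assms(2) in \<open>auto simp: power2_eq_square\<close>)

section \<open>Integral and rational neighbourhoods\<close>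

lemma arithmetic_map_mono: "arithmetic_map B f \<Longrightarrow> A \<subseteq> B \<Longrightarrow> arithmetic_map A f"
  unfolding arithmetic_map_def by blast

lemma arithmetic_map_power:
  assumes f: "arithmetic_map A f" and A: "\<And>k. 1 \<le> k \<Longrightarrow> k \<le> n \<Longrightarrow> g ^ k \<in> A"
    and k: "1 \<le> k" "k \<le> n"
  shows "f (g ^ k) = f g ^ k"
  using k
proof (induction k rule: dec_induct)
  case base
  then show ?case by simp
next
  case (step k)
  have "g \<in> A" "g ^ k \<in> A" "g * g ^ k \<in> A"
    using A[of 1] A[of k] A[of "Suc k"] step by auto
  then have "f (g * g ^ k) = f g * f (g ^ k)"
    using f by (simp add: arithmetic_map_def)
  then show ?case
    using step by simp
qed

text \<open>
  The number \<open>27\<close> is reached additively as \<open>5 \<cdot> 5 + 1 + 1\<close> and multiplicatively as \<open>3\<^sup>3\<close>, which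
  puts \<open>(f 3, f 5)\<close> on the curve. The intermediate results \<open>25\<close>, \<open>26\<close> and \<open>9\<close> all lie in
  \<open>B_fin n\<close>. Since only \<open>(f 5)\<^sup>2\<close> is determined, \<open>5\<close> itself may be sent to \<open>-5\<close>.
\<close>

lemma B_fin_integral_map_fixes:
  assumes n: "n \<ge> 3" and f: "arithmetic_map (B_fin n) f" and r: "r \<in> B_fin n - {1, 5}"
  shows "f r = r"
proof -
  have B: "1 \<in> B_fin n" "5 \<in> B_fin n" "25 \<in> B_fin n" "26 \<in> B_fin n"
    "\<And>k. 1 \<le> k \<Longrightarrow> k \<le> n \<Longrightarrow> 3 ^ k \<in> B_fin n"
    by (auto simp: B_fin_def)
  have pow: "f (3 ^ k) = f 3 ^ k" if "1 \<le> k" "k \<le> n" for k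
    using arithmetic_map_power[OF f B(5) that] by simp
  have 27: "27 \<in> B_fin n" "f 27 = f 3 ^ 3"
    using B(5)[of 3] pow[of 3] n by simp_all
  have add: "f (a + b) = f a + f b"
    if "a \<in> B_fin n" "b \<in> B_fin n" "a + b \<in> B_fin n" for a b
    using f that by (simp add: arithmetic_map_def)
  have one: "f 1 = 1"
    using f B by (simp add: arithmetic_map_def)
  have "5 * 5 \<in> B_fin n"
    using B(3) by simp
  then have "f (5 * 5) = f 5 * f 5"
    using f B(2) unfolding arithmetic_map_def by blast
  then have 25: "f 25 = (f 5)\<^sup>2"
    by (simp add: power2_eq_square)
  have 26: "f 26 = (f 5)\<^sup>2 + 1"
    using add[of 25 1] B one 25 by simp
  have "(f 5)\<^sup>2 + 2 = f 3 ^ 3"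
    using add[of 26 1] B 27 one 26 by simp
  then have 3: "f 3 = 3"
    by (rule fermat_square_plus_two_eq_cube)
  then have "(f 5)\<^sup>2 = 25"
    using \<open>(f 5)\<^sup>2 + 2 = f 3 ^ 3\<close> by simp
  then show ?thesis
    using r 25 26 pow 3 unfolding B_fin_def by auto
qed

theorem theorem2:
  "(\<exists>\<phi> :: rat \<Rightarrow> rat. arithmetic_map (rat_of_int ` B_all) \<phi> \<and>
      (\<forall>r \<in> rat_of_int ` B_all - {1}. \<phi> r \<noteq> r)) \<and>
   (\<forall>n\<ge>3. \<forall>r \<in> B_fin n - {1, 5}.
      arithmetic_neighbourhood (B_fin n) r \<and>
      \<not> arithmetic_neighbourhood (rat_of_int ` B_fin n) (rat_of_int r))"
proof (intro conjI allI impI ballI)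
  show "\<exists>\<phi> :: rat \<Rightarrow> rat. arithmetic_map (rat_of_int ` B_all) \<phi> \<and>
      (\<forall>r \<in> rat_of_int ` B_all - {1}. \<phi> r \<noteq> r)"
    using curve_point_map_arithmetic curve_point_map_moves by auto
next
  fix n :: nat and r
  assume n: "3 \<le> n" and r: "r \<in> B_fin n - {1, 5}"
  have "finite (B_fin n)"
    by (simp add: B_fin_def)
  then show "arithmetic_neighbourhood (B_fin n) r"
    using B_fin_integral_map_fixes[OF n _ r] r by (simp add: arithmetic_neighbourhood_def)
  have sub: "B_fin n \<subseteq> B_all"
    using n by (auto simp: B_all_def)
  then have "arithmetic_map (rat_of_int ` B_fin n) curve_point_map"
    using arithmetic_map_mono[OF curve_point_map_arithmetic] by blast
  moreover have "curve_point_map (of_int r) \<noteq> of_int r"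
    using curve_point_map_moves r sub by blast
  ultimately show "\<not> arithmetic_neighbourhood (rat_of_int ` B_fin n) (rat_of_int r)"
    by (auto simp: arithmetic_neighbourhood_def)
qed

end
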